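(* Let $\mathcal{V}$ be a finite ground set, let $k\ge 2$ be an integer with $|\mathcal{V}|\ge k$, and let $h:\mathcal{H}(\mathcal{V})\to\mathbb{R}_{\ge 0}$ with $h(())=0$ be forward-monotone, backward-monotone and sequence-submodular. Let $S$ be the sequence output by Algorithm 1 with parameters $k$ and $\tau=1$. Then $$\min_{\mathcal{V}'\subseteq\mathcal{V}(S),\,|\mathcal{V}'|\le 1} h(S-\mathcal{V}')\;\ge\;\max\left\{\frac{e-1}{2e},\ \frac{e^{\frac{k-2}{k-1}}-1}{2e^{\frac{k-2}{k-1}}-1}\right\}\cdot \mathrm{OPT}_1,$$ where $\mathrm{OPT}_1=\max_{S'\in\mathcal{H}(\mathcal{V}),\,|S'|\le k}\ \min_{\mathcal{V}'\subseteq\mathcal{V}(S'),\,|\mathcal{V}'|\le 1} h(S'-\mathcal{V}')$. In particular the ratio is at least the constant $\frac{e-1}{2e}$.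
   Context: $\mathcal{H}(\mathcal{V})$ denotes the set of all finite sequences $(v_1,\dots,v_m)$ of pairwise distinct elements of $\mathcal{V}$ ($0\le m\le|\mathcal{V}|$), including the empty sequence $()$. For $S\in\mathcal{H}(\mathcal{V})$, $\mathcal{V}(S)$ is the set of its elements and $|S|=|\mathcal{V}(S)|$. For a set $\mathcal{U}$, $S-\mathcal{U}$ is the sequence obtained from $S$ by deleting the elements of $\mathcal{U}$ and keeping the order of the remaining elements. For $S_1=(v_1,\dots,v_{m_1})$ and $S_2\in\mathcal{H}(\mathcal{V})$ with $S_2-\mathcal{V}(S_1)=(w_1,\dots,w_{m_3})$, the concatenation is $S_1\oplus S_2=(v_1,\dots,v_{m_1},w_1,\dots,w_{m_3})$. Write $S_1\preceq S_2$ if $S_2=S_1\oplus S_3$ for some $S_3\in\mathcal{H}(\mathcal{V})$. Marginal value: $h(S_2\mid S_1)=h(S_1\oplus S_2)-h(S_1)$; for an element $v$, $(v)$ is the one-element sequence. $h$ is forward-monotone if $h(S_1\oplus S_2)\ge h(S_1)$ for all $S_1,S_2$; backward-monotone if $h(S_1\oplus S_2)\ge h(S_2)$ for all $S_1,S_2$; sequence-submodular if $h(S_3\mid S_1)\ge h(S_3\mid S_2)$ for all $S_3$ and all $S_1\preceq S_2$. Algorithm 1 (parameters $k$, $\tau$ with $1\le\tau\le k$): Step 1: start with $S_1=()$ and, while $|S_1|<\tau$, set $S_1=S_1\oplus(v)$ with $v\in\arg\max_{v\in\mathcal{V}\setminus\mathcal{V}(S_1)}h((v)\mid S_1)$. Step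 2: start with $S_2=()$ and, while $|S_2|<k-\tau$, set $S_2=S_2\oplus(v)$ with $v\in\arg\max_{v\in\mathcal{V}\setminus(\mathcal{V}(S_1)\cup\mathcal{V}(S_2))}h((v)\mid S_2)$. Output $S=S_1\oplus S_2$. Ties in the argmax are broken arbitrarily. *)

theory Defs
  imports Complex_Main
begin

definition seqs :: "'a set \<Rightarrow> 'a list set" where
  "seqs V = {S. distinct S \<and> set S \<subseteq> V}"

definition seq_diff :: "'a list \<Rightarrow> 'a set \<Rightarrow> 'a list" where
  "seq_diff S U = filter (\<lambda>v. v \<notin> U) S"

definition seq_concat :: "'a list \<Rightarrow> 'a list \<Rightarrow> 'a list" (infixl "\<oplus>\<^sub>s" 65) where
  "S1 \<oplus>\<^sub>s S2 = S1 @ seq_diff S2 (set S1)"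

definition seq_prefix :: "'a set \<Rightarrow> 'a list \<Rightarrow> 'a list \<Rightarrow> bool" where
  "seq_prefix V S1 S2 \<longleftrightarrow> (\<exists>S3\<in>seqs V. S2 = S1 \<oplus>\<^sub>s S3)"

text \<open>\<open>marginal h S2 S1\<close> is $h(S_2 \mid S_1)$.\<close>

definition marginal :: "('a list \<Rightarrow> real) \<Rightarrow> 'a list \<Rightarrow> 'a list \<Rightarrow> real" where
  "marginal h S2 S1 = h (S1 \<oplus>\<^sub>s S2) - h S1"

text \<open>Functions on \<open>seqs V\<close> are rendered as total functions on lists; values elsewhere are
  unconstrained.\<close>

definition forward_monotone :: "'a set \<Rightarrow> ('a list \<Rightarrow> real) \<Rightarrow> bool" where
  "forward_monotone V h \<longleftrightarrow> (\<forall>S1\<in>seqs V. \<forall>S2\<in>seqs V. h (S1 \<oplus>\<^sub>s S2) \<ge> h S1)"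

definition backward_monotone :: "'a set \<Rightarrow> ('a list \<Rightarrow> real) \<Rightarrow> bool" where
  "backward_monotone V h \<longleftrightarrow> (\<forall>S1\<in>seqs V. \<forall>S2\<in>seqs V. h (S1 \<oplus>\<^sub>s S2) \<ge> h S2)"

definition sequence_submodular :: "'a set \<Rightarrow> ('a list \<Rightarrow> real) \<Rightarrow> bool" where
  "sequence_submodular V h \<longleftrightarrow>
     (\<forall>S1\<in>seqs V. \<forall>S2\<in>seqs V. \<forall>S3\<in>seqs V.
        seq_prefix V S1 S2 \<longrightarrow> marginal h S3 S1 \<ge> marginal h S3 S2)"

text \<open>The states reachable by the greedy loop with bound \<open>n\<close> that never selects an element
  of \<open>X\<close>. The argmax may be any maximiser, so several states can be reachable after the same
  number of iterations.\<close>

inductive greedy_reach ::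
  "'a set \<Rightarrow> ('a list \<Rightarrow> real) \<Rightarrow> 'a set \<Rightarrow> nat \<Rightarrow> 'a list \<Rightarrow> bool"
  for V :: "'a set" and h :: "'a list \<Rightarrow> real" and X :: "'a set" and n :: nat where
  init: "greedy_reach V h X n []"
| step: "greedy_reach V h X n S \<Longrightarrow> card (set S) < n \<Longrightarrow>
    is_arg_max (\<lambda>w. marginal h [w] S) (\<lambda>w. w \<in> V - (X \<union> set S)) v \<Longrightarrow>
    greedy_reach V h X n (S \<oplus>\<^sub>s [v])"

definition greedy_output ::
  "'a set \<Rightarrow> ('a list \<Rightarrow> real) \<Rightarrow> 'a set \<Rightarrow> nat \<Rightarrow> 'a list \<Rightarrow> bool" where
  "greedy_output V h X n S \<longleftrightarrow> greedy_reach V h X n S \<and> \<not> card (set S) < n"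

text \<open>The second loop evaluates marginals with respect to its own sequence only; the first
  sequence enters just as the set of forbidden elements.\<close>

definition algorithm1_output ::
  "'a set \<Rightarrow> ('a list \<Rightarrow> real) \<Rightarrow> nat \<Rightarrow> nat \<Rightarrow> 'a list \<Rightarrow> bool" where
  "algorithm1_output V h k \<tau> S \<longleftrightarrow>
     (\<exists>S1 S2. greedy_output V h {} \<tau> S1 \<and> greedy_output V h (set S1) (k - \<tau>) S2 \<and>
              S = S1 \<oplus>\<^sub>s S2)"

definition robust_value :: "('a list \<Rightarrow> real) \<Rightarrow> nat \<Rightarrow> 'a list \<Rightarrow> real" where
  "robust_value h r S = Min {h (seq_diff S U) | U. U \<subseteq> set S \<and> card U \<le> r}"

definition robust_opt :: "'a set \<Rightarrow> ('a list \<Rightarrow> real) \<Rightarrow> nat \<Rightarrow> nat \<Rightarrow> real" where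
  "robust_opt V h k r = Max {robust_value h r S | S. S \<in> seqs V \<and> card (set S) \<le> k}"

text \<open>The sets under \<open>Min\<close> and \<open>Max\<close> are finite and nonempty, so both extrema are attained.\<close>

lemma finite_seqs: "finite V \<Longrightarrow> finite (seqs V)"
  by (rule finite_subset[OF _ finite_subset_distinct[of V]]) (auto simp: seqs_def)

lemma robust_value_set:
  "finite {h (seq_diff S U) | U. U \<subseteq> set S \<and> card U \<le> r}"
  "{h (seq_diff S U) | U. U \<subseteq> set S \<and> card U \<le> r} \<noteq> {}"
proof -
  show "finite {h (seq_diff S U) | U. U \<subseteq> set S \<and> card U \<le> r}"
    by (rule finite_subset[of _ "(\<lambda>U. h (seq_diff S U)) ` Pow (set S)"]) auto
  have "{} \<subseteq> set S \<and> card {} \<le> r" by simp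
  then show "{h (seq_diff S U) | U. U \<subseteq> set S \<and> card U \<le> r} \<noteq> {}" by blast
qed

lemma robust_opt_set:
  assumes "finite V"
  shows "finite {robust_value h r S | S. S \<in> seqs V \<and> card (set S) \<le> k}"
    and "{robust_value h r S | S. S \<in> seqs V \<and> card (set S) \<le> k} \<noteq> {}"
proof -
  show "finite {robust_value h r S | S. S \<in> seqs V \<and> card (set S) \<le> k}"
    by (rule finite_subset[of _ "robust_value h r ` seqs V"]) (auto simp: finite_seqs assms)
  have "[] \<in> seqs V \<and> card (set []) \<le> k" by (simp add: seqs_def)
  then show "{robust_value h r S | S. S \<in> seqs V \<and> card (set S) \<le> k} \<noteq> {}" by blast
qed

end

theory Submission
  imports Defs
begin

text \<open>Write the output as \<open>x # S2\<close> and let \<open>u\<close> be the value of the first element of \<open>S2\<close>. Deleting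
  an element from an optimal sequence (\<open>x\<close>, if it occurs) leaves a sequence \<open>T\<close> of length at most
  \<open>k - 1\<close> that avoids \<open>x\<close> and has value at least the optimum. Hence the greedy recursion
  \<open>h T - h (S \<oplus>\<^sub>s [v]) \<le> (1 - 1 / (k - 1)) * (h T - h S)\<close> applies to \<open>S2\<close>; started at the empty
  sequence it bounds \<open>h S2\<close> by \<open>(1 - 1/e) h T\<close>, and started after the first step, with
  \<open>E = exp ((k - 2) / (k - 1))\<close>, by \<open>(1 - 1/E) h T + u/E\<close>.
  Deleting any one element leaves a value of at least \<open>u\<close>, by the choice of \<open>x\<close>, and of at least
  \<open>h S2 - u\<close>, by submodularity. Balancing the two lower bounds gives both ratios.\<close>

section \<open>Sequences, deletion and the robust optimum\<close>

lemma seqs_append_iff: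
  "A @ B \<in> seqs V \<longleftrightarrow> A \<in> seqs V \<and> B \<in> seqs V \<and> set A \<inter> set B = {}"
  by (auto simp: seqs_def)

lemma seqs_mono: "A \<in> seqs U \<Longrightarrow> U \<subseteq> V \<Longrightarrow> A \<in> seqs V"
  by (auto simp: seqs_def)

lemma seq_concat_disjoint: "set A \<inter> set B = {} \<Longrightarrow> A \<oplus>\<^sub>s B = A @ B"
  by (auto simp: seq_concat_def seq_diff_def filter_id_conv)

lemma seq_concat_in_seqs: "A \<in> seqs V \<Longrightarrow> B \<in> seqs V \<Longrightarrow> A \<oplus>\<^sub>s B \<in> seqs V"
  by (auto simp: seqs_def seq_concat_def seq_diff_def)

lemma seq_diff_in_seqs: "A \<in> seqs V \<Longrightarrow> seq_diff A U \<in> seqs (V - U)"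
  by (auto simp: seqs_def seq_diff_def)

lemma seq_concat_snoc:
  assumes "distinct (T @ [t])"
  shows "S \<oplus>\<^sub>s (T @ [t]) = (S \<oplus>\<^sub>s T) \<oplus>\<^sub>s [t]"
  using assms by (auto simp: seq_concat_def seq_diff_def)

lemma robust_value_le:
  "U \<subseteq> set S \<Longrightarrow> card U \<le> r \<Longrightarrow> robust_value h r S \<le> h (seq_diff S U)"
  unfolding robust_value_def by (rule Min_le[OF robust_value_set(1)]) blast

lemma robust_value_geI:
  assumes "\<And>U. U \<subseteq> set S \<Longrightarrow> card U \<le> r \<Longrightarrow> c \<le> h (seq_diff S U)"
  shows "c \<le> robust_value h r S"
  unfolding robust_value_def
  by (subst Min_ge_iff[OF robust_value_set]) (use assms in blast)

lemma robust_opt_le_avoiding: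
  assumes "finite V" and "k \<ge> 1"
  obtains T where "T \<in> seqs (V - {x})" "length T \<le> k - 1" "robust_opt V h k 1 \<le> h T"
proof -
  have "robust_opt V h k 1 \<in> {robust_value h 1 S | S. S \<in> seqs V \<and> card (set S) \<le> k}"
    unfolding robust_opt_def by (rule Max_in[OF robust_opt_set[OF assms(1)]])
  then obtain R where R: "R \<in> seqs V" "card (set R) \<le> k"
    and opt: "robust_opt V h k 1 = robust_value h 1 R" by blast
  \<comment> \<open>If \<open>x\<close> does not occur, the head is deleted merely to bring the
    length down to \<open>k - 1\<close>; the empty sequence is short enough already.\<close>
  define U where "U = (if x \<in> set R then {x} else if R = [] then {} else {hd R})"
  have U: "U \<subseteq> set R" "card U \<le> 1" by (auto simp: U_def)
  have "x \<notin> set (seq_diff R U)" by (auto simp: U_def seq_diff_def)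
  then have T: "seq_diff R U \<in> seqs (V - {x})"
    using seq_diff_in_seqs[OF R(1), of U] by (auto simp: seqs_def)
  have "length (seq_diff R U) = card (set R - U)"
    using R(1) distinct_card[of "seq_diff R U"]
    by (simp add: seqs_def seq_diff_def set_diff_eq)
  also have "\<dots> \<le> k - 1"
    using R(2) U(1) by (cases "R = []") (auto simp: U_def card_Diff_singleton)
  finally show thesis
    using that[OF T] robust_value_le[OF U] opt by simp
qed

section \<open>Runs of the greedy loop\<close>

lemma greedy_reach_in_seqs:
  assumes "greedy_reach V h X n S"
  shows "S \<in> seqs (V - X) \<and> length S \<le> n"
  using assms
proof (induction rule: greedy_reach.induct)
  case init
  then show ?case by (simp add: seqs_def)
next
  case (step S v)
  have "v \<in> V - (X \<union> set S)" using step.hyps(3) by (simp add: is_arg_max_def)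
  then show ?case
    using step.hyps(2) step.IH by (auto simp: seq_concat_disjoint seqs_def distinct_card)
qed

lemma greedy_output_length:
  "greedy_output V h X n S \<Longrightarrow> length S = n"
  using greedy_reach_in_seqs[of V h X n S]
  by (auto simp: greedy_output_def seqs_def distinct_card)

text \<open>Only the first iteration matters: marginals over \<open>[]\<close> differ from singleton
  values by the constant \<open>h []\<close>, and later iterations keep the head.\<close>

lemma greedy_reach_hd_max:
  assumes "greedy_reach V h X n S" "S \<noteq> []" "w \<in> V - X"
  shows "h [w] \<le> h [hd S]"
  using assms
proof (induction rule: greedy_reach.induct)
  case init
  then show ?case by simp
next
  case (step S v)
  show ?case
  proof (cases "S = []")
    case True
    then have "\<not> marginal h [w] [] > marginal h [v] []"
      using step.hyps(3) step.prems by (auto simp: is_arg_max_def)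
    then show ?thesis
      using True by (simp add: marginal_def seq_concat_disjoint)
  next
    case False
    then show ?thesis using step.IH step.prems by (simp add: seq_concat_def)
  qed
qed

section \<open>Value estimates for monotone sequence-submodular functions\<close>

locale monotone_submodular =
  fixes V :: "'a set" and h :: "'a list \<Rightarrow> real"
  assumes empty_value: "h [] = 0"
    and forward: "forward_monotone V h"
    and backward: "backward_monotone V h"
    and submodular: "sequence_submodular V h"
begin

lemma value_prefix_le:
  assumes "A @ B \<in> seqs V"
  shows "h A \<le> h (A @ B)"
proof -
  have "h A \<le> h (A \<oplus>\<^sub>s B)"
    using forward assms by (auto simp: forward_monotone_def seqs_append_iff)
  then show ?thesis using assms by (simp add: seqs_append_iff seq_concat_disjoint)
qed

lemma value_suffix_le:
  assumes "A @ B \<in> seqs V"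
  shows "h B \<le> h (A @ B)"
proof -
  have "h B \<le> h (A \<oplus>\<^sub>s B)"
    using backward assms by (auto simp: backward_monotone_def seqs_append_iff)
  then show ?thesis using assms by (simp add: seqs_append_iff seq_concat_disjoint)
qed

lemma value_nonneg: "A \<in> seqs V \<Longrightarrow> 0 \<le> h A"
  using value_prefix_le[of "[]" A] empty_value by simp

lemma marginal_concat_le:
  assumes "A \<in> seqs V" "B \<in> seqs V" "C \<in> seqs V"
  shows "marginal h C (A \<oplus>\<^sub>s B) \<le> marginal h C A"
proof -
  have "seq_prefix V A (A \<oplus>\<^sub>s B)" using assms(2) by (auto simp: seq_prefix_def)
  then show ?thesis
    using submodular assms seq_concat_in_seqs[OF assms(1,2)]
    unfolding sequence_submodular_def by blast
qed

lemma marginal_append_le: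
  assumes "A @ B @ C \<in> seqs V"
  shows "h (A @ B @ C) - h (A @ B) \<le> h (A @ C) - h A"
proof -
  have disj: "set A \<inter> set B = {}" "set A \<inter> set C = {}" "set (A @ B) \<inter> set C = {}"
    and "A \<in> seqs V" "B \<in> seqs V" "C \<in> seqs V"
    using assms by (auto simp: seqs_def)
  then have "marginal h C (A \<oplus>\<^sub>s B) \<le> marginal h C A" by (intro marginal_concat_le)
  then show ?thesis
    using disj by (simp add: marginal_def seq_concat_disjoint)
qed

text \<open>Two diminishing returns are added: \<open>B\<close> gains after \<open>A @ [v]\<close>
  at most what it gains after \<open>A\<close>, and \<open>v\<close> gains after \<open>A\<close> at
  most what it gains after \<open>[]\<close>, namely \<open>h [v]\<close>.\<close>

lemma value_delete_ge:
  assumes "A @ [v] @ B \<in> seqs V"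
  shows "h (A @ [v] @ B) - h [v] \<le> h (A @ B)"
proof -
  have "[] @ A @ [v] \<in> seqs V" using assms by (auto simp: seqs_def)
  from marginal_append_le[OF assms] marginal_append_le[OF this] show ?thesis
    by (simp add: empty_value)
qed

text \<open>The elements of \<open>T\<close> are appended one at a time; by submodularity each gains
  at most what it would gain directly after \<open>S\<close>.\<close>

lemma value_concat_le:
  assumes "S \<in> seqs V" "T \<in> seqs V" "0 \<le> g"
    and "\<And>t. t \<in> set T - set S \<Longrightarrow> marginal h [t] S \<le> g"
  shows "h (S \<oplus>\<^sub>s T) \<le> h S + real (length T) * g"
  using assms(2,4)
proof (induction T rule: rev_induct)
  case Nil
  then show ?case by (simp add: seq_concat_def seq_diff_def)
next
  case (snoc t T)
  have T: "T \<in> seqs V" "[t] \<in> seqs V" "distinct (T @ [t])"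
    using snoc.prems(1) by (auto simp: seqs_def)
  \<comment> \<open>An element already in \<open>S\<close> has marginal 0, which is where
    \<open>0 \<le> g\<close> enters.\<close>
  have "marginal h [t] S \<le> g"
    using snoc.prems(2)[of t] assms(3)
    by (cases "t \<in> set S") (auto simp: marginal_def seq_concat_def seq_diff_def)
  then have "marginal h [t] (S \<oplus>\<^sub>s T) \<le> g"
    using marginal_concat_le[OF assms(1) T(1,2)] by linarith
  moreover have "h (S \<oplus>\<^sub>s T) \<le> h S + real (length T) * g"
    using snoc.IH[OF T(1)] snoc.prems(2) by auto
  ultimately show ?case
    by (simp add: seq_concat_snoc[OF T(3)] marginal_def algebra_simps)
qed

text \<open>Backward monotonicity gives \<open>h T \<le> h (S \<oplus>\<^sub>s T)\<close>. Elements
  of \<open>T\<close> outside \<open>S\<close> are candidates for the greedy choice, so at most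
  \<open>n\<close> gains, each bounded by the greedy gain, cover the gap
  \<open>h T - h S\<close>.\<close>

lemma greedy_step_gap:
  assumes S: "S \<in> seqs (V - X)" and T: "T \<in> seqs (V - X)" "length T \<le> n" and "0 < n"
    and v: "is_arg_max (\<lambda>w. marginal h [w] S) (\<lambda>w. w \<in> V - (X \<union> set S)) v"
  shows "h T - h (S \<oplus>\<^sub>s [v]) \<le> (1 - 1 / real n) * (h T - h S)"
proof -
  define g where "g = marginal h [v] S"
  have SV: "S \<in> seqs V" and TV: "T \<in> seqs V" using S T seqs_mono by blast+
  have "v \<in> V - (X \<union> set S)" using v by (simp add: is_arg_max_def)
  then have "S @ [v] \<in> seqs V" "S \<oplus>\<^sub>s [v] = S @ [v]"
    using SV by (auto simp: seqs_def seq_concat_disjoint)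
  \<comment> \<open>The sign also permits replacing \<open>length T\<close> by \<open>n\<close>
    below.\<close>
  then have g0: "0 \<le> g"
    using value_prefix_le[of S "[v]"] by (simp add: g_def marginal_def)
  have "h T \<le> h (S \<oplus>\<^sub>s T)"
    using backward SV TV by (auto simp: backward_monotone_def)
  also have "\<dots> \<le> h S + real (length T) * g"
  proof (rule value_concat_le[OF SV TV g0])
    fix t assume "t \<in> set T - set S"
    then have "t \<in> V - (X \<union> set S)" using T(1) by (auto simp: seqs_def)
    then show "marginal h [t] S \<le> g"
      using v by (auto simp: is_arg_max_def g_def not_less)
  qed
  also have "\<dots> \<le> h S + real n * g"
    using T(2) g0 by (simp add: mult_right_mono)
  finally have "(h T - h S) / real n \<le> g"
    using \<open>0 < n\<close> by (simp add: field_simps)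
  then show ?thesis by (simp add: g_def marginal_def algebra_simps diff_divide_distrib)
qed

text \<open>Iterates the one-step contraction. The second bound starts the iteration after the first
  choice, so it retains \<open>h [hd S]\<close> and has one factor fewer.\<close>

lemma greedy_reach_gap:
  assumes "greedy_reach V h X n S" and T: "T \<in> seqs (V - X)" "length T \<le> n" and "0 < n"
  shows "h T - h S \<le> (1 - 1 / real n) ^ length S * h T"
    and "S \<noteq> [] \<Longrightarrow> h T - h S \<le> (1 - 1 / real n) ^ (length S - 1) * (h T - h [hd S])"
proof -
  let ?q = "1 - 1 / real n"
  \<comment> \<open>The gap may be negative, so scaling the induction hypothesis needs only this
    sign; for \<open>n = 1\<close> the factor is 0.\<close>
  have q: "0 \<le> ?q" using \<open>0 < n\<close> by simp
  have "h T - h S \<le> ?q ^ length S * h T \<and>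
    (S \<noteq> [] \<longrightarrow> h T - h S \<le> ?q ^ (length S - 1) * (h T - h [hd S]))"
    using assms(1)
  proof (induction rule: greedy_reach.induct)
    case init
    then show ?case by (simp add: empty_value)
  next
    case (step S v)
    have "v \<in> V - (X \<union> set S)" using step.hyps(3) by (simp add: is_arg_max_def)
    then have Sv: "S \<oplus>\<^sub>s [v] = S @ [v]" by (simp add: seq_concat_disjoint)
    have "S \<in> seqs (V - X)" using greedy_reach_in_seqs[OF step.hyps(1)] by blast
    from greedy_step_gap[OF this T \<open>0 < n\<close> step.hyps(3)]
    have gap: "h T - h (S @ [v]) \<le> ?q * (h T - h S)" by (simp add: Sv)
    have "h T - h (S @ [v]) \<le> ?q ^ length (S @ [v]) * h T"
      using gap mult_left_mono[OF conjunct1[OF step.IH] q] by (simp add: mult.assoc)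
    moreover have "h T - h (S @ [v]) \<le> ?q ^ length S * (h T - h [hd (S @ [v])])"
    \<comment> \<open>For empty \<open>S\<close> the new sequence is \<open>[v]\<close> and the
      exponent is 0, so both sides agree.\<close>
    proof (cases "S = []")
      case False
      then obtain m where m: "length S = Suc m" by (cases S) auto
      have "?q * (h T - h S) \<le> ?q * (?q ^ m * (h T - h [hd S]))"
        using step.IH False m q by (intro mult_left_mono) auto
      then show ?thesis using gap False m by (simp add: mult.assoc)
    qed simp
    ultimately show ?case by (simp add: Sv)
  qed
  then show "h T - h S \<le> ?q ^ length S * h T"
    and "S \<noteq> [] \<Longrightarrow> h T - h S \<le> ?q ^ (length S - 1) * (h T - h [hd S])" by auto
qed

text \<open>The element \<open>x\<close> insures against losing the head of \<open>S\<close>: if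
  \<open>x\<close> survives, it alone is worth at least \<open>h [hd S]\<close>; if \<open>x\<close>
  is deleted, all of \<open>S\<close> remains. Deleting some \<open>y\<close> from \<open>S\<close>
  costs at most \<open>h [y]\<close>, hence at most \<open>h [hd S]\<close>.\<close>

lemma robust_value_Cons_ge:
  assumes xS: "x # S \<in> seqs V" and "S \<noteq> []"
    and max_x: "\<And>w. w \<in> V \<Longrightarrow> h [w] \<le> h [x]"
    and max_hd: "\<And>w. w \<in> set S \<Longrightarrow> h [w] \<le> h [hd S]"
  shows "max (h [hd S]) (h S - h [hd S]) \<le> robust_value h 1 (x # S)"
proof (rule robust_value_geI)
  fix U assume U: "U \<subseteq> set (x # S)" "card U \<le> 1"
  have hdV: "hd S \<in> V" using xS \<open>S \<noteq> []\<close> by (cases S) (auto simp: seqs_def)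
  have u0: "0 \<le> h [hd S]" using hdV by (intro value_nonneg) (simp add: seqs_def)
  have hd_le: "h [hd S] \<le> h [x]" using max_x hdV by blast
  have S: "S \<in> seqs V" "x \<notin> set S" "distinct S" using xS by (auto simp: seqs_def)
  have hdS: "h [hd S] \<le> h S"
    using value_prefix_le[of "[hd S]" "tl S"] S \<open>S \<noteq> []\<close> by simp
  consider "U = {}" | "U = {x}" | y where "U = {y}" "y \<in> set S"
  proof -
    have "finite U" using U(1) finite_subset by blast
    then have "U = {} \<or> (\<exists>y. U = {y})"
      using U(2) by (metis card_0_eq card_1_singletonE le_antisym less_one not_le)
    then show thesis using U(1) that by auto
  qed
  then show "max (h [hd S]) (h S - h [hd S]) \<le> h (seq_diff (x # S) U)"
  proof cases
    case 1
    then show ?thesis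
      using value_suffix_le[of "[x]" S] xS hdS u0 by (simp add: seq_diff_def)
  next
    case 2
    have "seq_diff (x # S) {x} = S"
      using S(2) by (auto simp: seq_diff_def filter_id_conv)
    then show ?thesis using 2 hdS u0 by simp
  next
    case 3
    obtain A B where AB: "S = A @ [y] @ B" using split_list[OF 3(2)] by auto
    have "filter (\<lambda>v. v \<noteq> y) A = A" "filter (\<lambda>v. v \<noteq> y) B = B"
      using S(3) AB by (auto simp: filter_id_conv)
    then have D: "seq_diff (x # S) U = [x] @ A @ B"
      using S(2) 3 AB by (auto simp: seq_diff_def)
    have in_seqs: "[x] @ A @ B \<in> seqs V" using xS AB by (auto simp: seqs_def)
    have "h S - h [hd S] \<le> h S - h [y]" using max_hd 3(2) by simp
    also have "\<dots> \<le> h (A @ B)" using value_delete_ge[of A y B] S(1) AB by simp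
    also have "\<dots> \<le> h ([x] @ A @ B)" by (rule value_suffix_le[OF in_seqs])
    finally show ?thesis
      using value_prefix_le[OF in_seqs] hd_le D by simp
  qed
qed

end

section \<open>The exponential estimate and the two approximation ratios\<close>

lemma one_minus_inverse_power_le_exp:
  assumes "0 < n"
  shows "(1 - 1 / real n) ^ m \<le> exp (- (real m / real n))"
proof -
  have "(1 - 1 / real n) ^ m \<le> exp (- 1 / real n) ^ m"
    using assms exp_ge_add_one_self[of "- 1 / real n"] by (intro power_mono) auto
  also have "\<dots> = exp (- (real m / real n))" by (simp flip: exp_of_nat_mult)
  finally show ?thesis .
qed

theorem theorem1:
  fixes V :: "'a set" and h :: "'a list \<Rightarrow> real" and k :: nat and S :: "'a list"
  assumes "finite V"
    and "k \<ge> 2"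
    and "card V \<ge> k"
    and "\<forall>T\<in>seqs V. h T \<ge> 0"
    and "h [] = 0"
    and "forward_monotone V h"
    and "backward_monotone V h"
    and "sequence_submodular V h"
    and "algorithm1_output V h k 1 S"
  shows "robust_value h 1 S \<ge>
           max ((exp 1 - 1) / (2 * exp 1))
               ((exp ((real k - 2) / (real k - 1)) - 1) /
                (2 * exp ((real k - 2) / (real k - 1)) - 1)) * robust_opt V h k 1
       \<and> robust_value h 1 S \<ge> (exp 1 - 1) / (2 * exp 1) * robust_opt V h k 1"
proof -
  interpret monotone_submodular V h using assms by unfold_locales
  obtain S1 S2 where S1: "greedy_output V h {} 1 S1"
    and S2: "greedy_output V h (set S1) (k - 1) S2" and S: "S = S1 \<oplus>\<^sub>s S2"
    using assms(9) by (auto simp: algorithm1_output_def)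
  obtain x where x: "S1 = [x]"
    using greedy_output_length[OF S1] by (cases S1) auto
  have r1: "greedy_reach V h {} 1 [x]" and r2: "greedy_reach V h {x} (k - 1) S2"
    using S1 S2 x by (auto simp: greedy_output_def)
  have len: "length S2 = k - 1" using greedy_output_length[OF S2] .
  then have ne: "S2 \<noteq> []" using assms(2) by auto
  have S2V: "S2 \<in> seqs (V - {x})" and xV: "x \<in> V"
    using greedy_reach_in_seqs[OF r2] greedy_reach_in_seqs[OF r1] by (auto simp: seqs_def)
  have xS2: "x # S2 \<in> seqs V" using S2V xV by (auto simp: seqs_def)
  have Seq: "S = x # S2" using xS2 S x seq_concat_disjoint[of "[x]" S2] by (simp add: seqs_def)
  define u where "u = h [hd S2]"
  define E where "E = exp ((real k - 2) / (real k - 1))"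
  define OPT where "OPT = robust_opt V h k 1"
  define R where "R = robust_value h 1 S"
  have "max u (h S2 - u) \<le> R"
    unfolding u_def R_def Seq
  proof (rule robust_value_Cons_ge[OF xS2 ne])
    show "h [w] \<le> h [x]" if "w \<in> V" for w
      using greedy_reach_hd_max[OF r1, of w] that by simp
    show "h [w] \<le> h [hd S2]" if "w \<in> set S2" for w
      using greedy_reach_hd_max[OF r2 ne, of w] that S2V by (auto simp: seqs_def)
  qed
  then have R: "u \<le> R" "h S2 - u \<le> R" by auto
  obtain T where T: "T \<in> seqs (V - {x})" "length T \<le> k - 1" and OPT: "OPT \<le> h T"
    using robust_opt_le_avoiding[OF assms(1), of k x h] assms(2) unfolding OPT_def by auto
  have n: "0 < k - 1" using assms(2) by simp
  have hT: "0 \<le> h T" using T(1) seqs_mono value_nonneg by blast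
  \<comment> \<open>Equality holds for \<open>k = 2\<close>; in every case the denominator
    \<open>2 * E - 1\<close> is positive.\<close>
  have E1: "1 \<le> E" using assms(2) by (simp add: E_def)

  have "h T - h S2 \<le> (1 - 1 / real (k - 1)) ^ (k - 1) * h T"
    using greedy_reach_gap(1)[OF r2 T n] len by simp
  also have "\<dots> \<le> exp (- 1) * h T"
    using one_minus_inverse_power_le_exp[OF n, of "k - 1"] n hT by (intro mult_right_mono) auto
  finally have "(1 - exp (- 1)) * h T \<le> h S2" by (simp add: algebra_simps)
  \<comment> \<open>Adding the two lower bounds on \<open>R\<close> cancels
    \<open>u\<close>.\<close>
  also have "\<dots> \<le> 2 * R" using R by simp
  finally have "(1 - exp (- 1)) * h T \<le> 2 * R" .
  moreover have "(1 - exp (- 1)) * OPT \<le> (1 - exp (- 1)) * h T"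
    using OPT by (intro mult_left_mono) auto
  ultimately have "(1 - exp (- 1)) * OPT / 2 \<le> R" by linarith
  moreover have "(exp 1 - 1) / (2 * exp 1) * OPT = (1 - exp (- 1)) * OPT / 2"
    by (simp add: exp_minus field_simps)
  ultimately have bound1: "(exp 1 - 1) / (2 * exp 1) * OPT \<le> R" by (simp only:)

  have bound2: "(E - 1) / (2 * E - 1) * OPT \<le> R"
  \<comment> \<open>Replacing the power by the exponential requires \<open>h T - u\<close> to be
    nonnegative; otherwise \<open>R\<close> exceeds \<open>h T\<close> through \<open>u\<close>
    alone.\<close>
  proof (cases "u \<le> h T")
    case True
    \<comment> \<open>The exponent is \<open>k - 2\<close> because the first of the
      \<open>k - 1\<close> greedy choices is already accounted for by \<open>u\<close>.\<close>
    have "h T - h S2 \<le> (1 - 1 / real (k - 1)) ^ (k - 2) * (h T - u)"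
      using greedy_reach_gap(2)[OF r2 T n ne] len by (simp add: u_def numeral_2_eq_2)
    also have "\<dots> \<le> exp (- (real (k - 2) / real (k - 1))) * (h T - u)"
      using one_minus_inverse_power_le_exp[OF n] True by (intro mult_right_mono) auto
    also have "exp (- (real (k - 2) / real (k - 1))) = 1 / E"
      using assms(2) by (simp add: E_def exp_minus of_nat_diff inverse_eq_divide)
    finally have "E * (h T - h S2) \<le> h T - u" using E1 by (simp add: field_simps)
    \<comment> \<open>Eliminating \<open>h S2\<close> leaves
      \<open>(E - 1) * h T \<le> E * R + (E - 1) * u\<close>, and \<open>u \<le> R\<close> then
      removes \<open>u\<close>.\<close>
    moreover have "E * h S2 \<le> E * (R + u)" using R E1 by (intro mult_left_mono) auto
    moreover have "(E - 1) * u \<le> (E - 1) * R" using R E1 by (intro mult_left_mono) auto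
    ultimately have "(E - 1) * h T \<le> (2 * E - 1) * R" by (simp add: algebra_simps)
    moreover have "(E - 1) * OPT \<le> (E - 1) * h T" using OPT E1 by (intro mult_left_mono) auto
    ultimately show ?thesis using E1 by (simp add: field_simps)
  next
    case False
    then have "h T \<le> R" using R by simp
    moreover have "(E - 1) / (2 * E - 1) * OPT \<le> (E - 1) / (2 * E - 1) * h T"
      using OPT E1 by (intro mult_left_mono) auto
    \<comment> \<open>The ratio lies between 0 and 1 since \<open>E\<close> is at least 1.\<close>
    moreover have "(E - 1) / (2 * E - 1) * h T \<le> h T"
      using E1 hT by (intro mult_left_le_one_le) auto
    ultimately show ?thesis by linarith
  qed
  show ?thesis
    using bound1 bound2 unfolding E_def OPT_def R_def
    unfolding max_def by presburger
qed

end
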